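(* For every $\lambda$-variable $x$, term $t$ and value $v$ we have $(\lambda x\,t)\,v\equiv t[x:=v]$.
   Context: Fix pairwise disjoint countably infinite sets of $\lambda$-variables ($x,y,\dots$), stack variables ($\alpha,\beta,\dots$), term variables ($a,b,\dots$), and countable sets of labels $l$ and constructors $C$. Values, terms, stacks, processes: $v,w::=x\mid\lambda x\,t\mid C[v]\mid\{l_i=v_i\}_{i\in I}$; $t,u::=a\mid v\mid t\,u\mid\mu\alpha\,t\mid p\mid v.l\mid\mathrm{case}_v[C_i[x_i]\to t_i]_{i\in I}\mid\delta_{v,w}$; $\pi::=\alpha\mid v.\pi\mid[t]\pi$; $p::=t\ast\pi$; $I$ finite; $\lambda x$, $\mu\alpha$ and the $x_i$ in case branches are binders, term variables are never bound. Substitutions map $\lambda$-variables to values, stack variables to stacks, term variables to terms (capture-avoiding). $\succ$ is the smallest relation on processes with: $t\,u\ast\pi\succ u\ast[t]\pi$; $v\ast[t]\pi\succ t\ast v.\pi$; $\lambda x\,t\ast v.\pi\succ t[x:=v]\ast\pi$; $\mu\alpha\,t\ast\pi\succ t[\alpha:=\pi]\ast\pi$; $p\ast\pi\succ p$; $\{l_i=v_i\}_{i\in I}.l_k\ast\pi\succ v_k\ast\pi$ ($k\in I$); $\mathrm{case}_{C_k[v]}[C_i[x_i]\to t_i]_{i\in I}\ast\pi\succ t_k[x_k:=v]\ast\pi$ ($k\in I$). A process is final if it is $v\ast\alpha$ with $v$ a value and $\alpha$ a stack variable; for a relation $R$, $p\Downarrow_R$ means $p\,R^*\,q$ with $q$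 final. For $i\in\mathbb N$, inductively: $\rightsquigarrow_i=\succ\cup\{(\delta_{v,w}\ast\pi,v\ast\pi)\mid\exists j<i,\ v\not\equiv_jw\}$; $t\equiv_iu$ iff for all $j\le i$, stacks $\pi$, substitutions $\sigma$: $t\sigma\ast\pi\Downarrow_{\rightsquigarrow_j}\Leftrightarrow u\sigma\ast\pi\Downarrow_{\rightsquigarrow_j}$; $\not\equiv_i$ is its negation. $\equiv=\bigcap_i\equiv_i$. *)

theory Defs
  imports Main "HOL-Library.Countable" "HOL-Library.Finite_Map"
begin

type_synonym lvar = nat
type_synonym svar = nat
type_synonym tvar = nat

text \<open>
  Syntax up to renaming of bound variables, in de Bruijn style with two independent index spaces.
  An index of a \<open>\<lambda>\<close>-variable pointing beyond all enclosing binders denotes a free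
  variable, so at top level the \<open>\<lambda>\<close>-variables are exactly the natural numbers, and
  likewise for stack variables; term variables are never bound and are plain names.
  \<open>LAM\<close> and each branch of \<open>CASE\<close> bind the \<open>\<lambda>\<close>-index 0, \<open>MU\<close> binds the
  stack index 0. The binders of the calculus, which take a variable \<^emph>\<open>name\<close>, are the
  functions \<open>lam\<close>, \<open>mu\<close> and \<open>cas\<close> below. A family indexed by a finite set of
  labels (constructors) is a finite map.
\<close>

datatype ('l, 'c) val =
    Var lvar
  | LAM "('l, 'c) trm"
  | Constr 'c "('l, 'c) val"
  | Record "('l, ('l, 'c) val) fmap"
and ('l, 'c) trm =
    TVar tvar
  | Val "('l, 'c) val"
  | App "('l, 'c) trm" "('l, 'c) trm"
  | MU "('l, 'c) trm"
  | Proc "('l, 'c) prc"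
  | Proj "('l, 'c) val" 'l
  | CASE "('l, 'c) val" "('c, ('l, 'c) trm) fmap"
  | Delta "('l, 'c) val" "('l, 'c) val"
and ('l, 'c) stk =
    SVar svar
  | Push "('l, 'c) val" "('l, 'c) stk"
  | Frame "('l, 'c) trm" "('l, 'c) stk"
and ('l, 'c) prc =
    Cut "('l, 'c) trm" "('l, 'c) stk"  (infix "\<star>" 60)

definition lift :: "(nat \<Rightarrow> nat) \<Rightarrow> nat \<Rightarrow> nat" where
  "lift f = case_nat 0 (\<lambda>k. Suc (f k))"

text \<open>Renaming of the free \<open>\<lambda>\<close>-variables by \<open>f\<close> and the free stack variables by \<open>g\<close>.\<close>

primrec
  ren_v :: "('l, 'c) val \<Rightarrow> (lvar \<Rightarrow> lvar) \<Rightarrow> (svar \<Rightarrow> svar) \<Rightarrow> ('l, 'c) val" and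
  ren_t :: "('l, 'c) trm \<Rightarrow> (lvar \<Rightarrow> lvar) \<Rightarrow> (svar \<Rightarrow> svar) \<Rightarrow> ('l, 'c) trm" and
  ren_s :: "('l, 'c) stk \<Rightarrow> (lvar \<Rightarrow> lvar) \<Rightarrow> (svar \<Rightarrow> svar) \<Rightarrow> ('l, 'c) stk" and
  ren_p :: "('l, 'c) prc \<Rightarrow> (lvar \<Rightarrow> lvar) \<Rightarrow> (svar \<Rightarrow> svar) \<Rightarrow> ('l, 'c) prc"
where
  "ren_v (Var x) f g = Var (f x)"
| "ren_v (LAM t) f g = LAM (ren_t t (lift f) g)"
| "ren_v (Constr c v) f g = Constr c (ren_v v f g)"
| "ren_v (Record vs) f g = Record (fmmap (\<lambda>v. ren_v v f g) vs)"
| "ren_t (TVar a) f g = TVar a"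
| "ren_t (Val v) f g = Val (ren_v v f g)"
| "ren_t (App t u) f g = App (ren_t t f g) (ren_t u f g)"
| "ren_t (MU t) f g = MU (ren_t t f (lift g))"
| "ren_t (Proc p) f g = Proc (ren_p p f g)"
| "ren_t (Proj v l) f g = Proj (ren_v v f g) l"
| "ren_t (CASE v ts) f g = CASE (ren_v v f g) (fmmap (\<lambda>t. ren_t t (lift f) g) ts)"
| "ren_t (Delta v w) f g = Delta (ren_v v f g) (ren_v w f g)"
| "ren_s (SVar \<alpha>) f g = SVar (g \<alpha>)"
| "ren_s (Push v \<pi>) f g = Push (ren_v v f g) (ren_s \<pi> f g)"
| "ren_s (Frame t \<pi>) f g = Frame (ren_t t f g) (ren_s \<pi> f g)"
| "ren_p (t \<star> \<pi>) f g = ren_t t f g \<star> ren_s \<pi> f g"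

datatype ('l, 'c) sbst =
  Sbst (on_lvar: "lvar \<Rightarrow> ('l, 'c) val")
       (on_svar: "svar \<Rightarrow> ('l, 'c) stk")
       (on_tvar: "tvar \<Rightarrow> ('l, 'c) trm")

definition up_l :: "('l, 'c) sbst \<Rightarrow> ('l, 'c) sbst" where
  "up_l \<sigma> = Sbst (case_nat (Var 0) (\<lambda>k. ren_v (on_lvar \<sigma> k) Suc id))
                 (\<lambda>\<alpha>. ren_s (on_svar \<sigma> \<alpha>) Suc id)
                 (\<lambda>a. ren_t (on_tvar \<sigma> a) Suc id)"

definition up_s :: "('l, 'c) sbst \<Rightarrow> ('l, 'c) sbst" where
  "up_s \<sigma> = Sbst (\<lambda>x. ren_v (on_lvar \<sigma> x) id Suc)
                 (case_nat (SVar 0) (\<lambda>k. ren_s (on_svar \<sigma> k) id Suc))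
                 (\<lambda>a. ren_t (on_tvar \<sigma> a) id Suc)"

text \<open>Capture-avoiding simultaneous substitution.\<close>

primrec
  sub_v :: "('l, 'c) val \<Rightarrow> ('l, 'c) sbst \<Rightarrow> ('l, 'c) val" and
  sub_t :: "('l, 'c) trm \<Rightarrow> ('l, 'c) sbst \<Rightarrow> ('l, 'c) trm" and
  sub_s :: "('l, 'c) stk \<Rightarrow> ('l, 'c) sbst \<Rightarrow> ('l, 'c) stk" and
  sub_p :: "('l, 'c) prc \<Rightarrow> ('l, 'c) sbst \<Rightarrow> ('l, 'c) prc"
where
  "sub_v (Var x) \<sigma> = on_lvar \<sigma> x"
| "sub_v (LAM t) \<sigma> = LAM (sub_t t (up_l \<sigma>))"
| "sub_v (Constr c v) \<sigma> = Constr c (sub_v v \<sigma>)"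
| "sub_v (Record vs) \<sigma> = Record (fmmap (\<lambda>v. sub_v v \<sigma>) vs)"
| "sub_t (TVar a) \<sigma> = on_tvar \<sigma> a"
| "sub_t (Val v) \<sigma> = Val (sub_v v \<sigma>)"
| "sub_t (App t u) \<sigma> = App (sub_t t \<sigma>) (sub_t u \<sigma>)"
| "sub_t (MU t) \<sigma> = MU (sub_t t (up_s \<sigma>))"
| "sub_t (Proc p) \<sigma> = Proc (sub_p p \<sigma>)"
| "sub_t (Proj v l) \<sigma> = Proj (sub_v v \<sigma>) l"
| "sub_t (CASE v ts) \<sigma> = CASE (sub_v v \<sigma>) (fmmap (\<lambda>t. sub_t t (up_l \<sigma>)) ts)"
| "sub_t (Delta v w) \<sigma> = Delta (sub_v v \<sigma>) (sub_v w \<sigma>)"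
| "sub_s (SVar \<alpha>) \<sigma> = on_svar \<sigma> \<alpha>"
| "sub_s (Push v \<pi>) \<sigma> = Push (sub_v v \<sigma>) (sub_s \<pi> \<sigma>)"
| "sub_s (Frame t \<pi>) \<sigma> = Frame (sub_t t \<sigma>) (sub_s \<pi> \<sigma>)"
| "sub_p (t \<star> \<pi>) \<sigma> = sub_t t \<sigma> \<star> sub_s \<pi> \<sigma>"

definition subst_l :: "('l, 'c) trm \<Rightarrow> lvar \<Rightarrow> ('l, 'c) val \<Rightarrow> ('l, 'c) trm"
    ("_[_ :=\<^sub>\<lambda> _]" [1000, 0, 0] 1000) where
  "t[x :=\<^sub>\<lambda> v] = sub_t t (Sbst (Var(x := v)) SVar TVar)"

definition subst_s :: "('l, 'c) trm \<Rightarrow> svar \<Rightarrow> ('l, 'c) stk \<Rightarrow> ('l, 'c) trm"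
    ("_[_ :=\<^sub>\<mu> _]" [1000, 0, 0] 1000) where
  "t[\<alpha> :=\<^sub>\<mu> \<pi>] = sub_t t (Sbst Var (SVar(\<alpha> := \<pi>)) TVar)"

text \<open>
  Abstraction of a named variable: \<open>x\<close> becomes index 0 and every other variable is shifted
  past the new binder. Every \<open>LAM s\<close> equals \<open>lam x t\<close> for some \<open>t\<close>, with any \<open>x\<close>
  not free in \<open>LAM s\<close>; two such presentations are exactly the \<open>\<alpha>\<close>-variants of each other, so the
  reduction rules below, stated with names, do not depend on the presentation chosen.
\<close>

definition bind :: "nat \<Rightarrow> nat \<Rightarrow> nat" where
  "bind x y = (if y = x then 0 else Suc y)"

definition lam :: "lvar \<Rightarrow> ('l, 'c) trm \<Rightarrow> ('l, 'c) val" where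
  "lam x t = LAM (ren_t t (bind x) id)"

definition mu :: "svar \<Rightarrow> ('l, 'c) trm \<Rightarrow> ('l, 'c) trm" where
  "mu \<alpha> t = MU (ren_t t id (bind \<alpha>))"

definition cas :: "('l, 'c) val \<Rightarrow> ('c, lvar \<times> ('l, 'c) trm) fmap \<Rightarrow> ('l, 'c) trm" where
  "cas v bs = CASE v (fmmap (\<lambda>(x, t). ren_t t (bind x) id) bs)"

inductive red :: "('l, 'c) prc \<Rightarrow> ('l, 'c) prc \<Rightarrow> bool"  (infix "\<succ>" 50) where
  "App t u \<star> \<pi> \<succ> u \<star> Frame t \<pi>"
| "Val v \<star> Frame t \<pi> \<succ> t \<star> Push v \<pi>"
| "Val (lam x t) \<star> Push v \<pi> \<succ> t[x :=\<^sub>\<lambda> v] \<star> \<pi>"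
| "mu \<alpha> t \<star> \<pi> \<succ> t[\<alpha> :=\<^sub>\<mu> \<pi>] \<star> \<pi>"
| "Proc p \<star> \<pi> \<succ> p"
| "fmlookup vs l = Some v \<Longrightarrow> Proj (Record vs) l \<star> \<pi> \<succ> Val v \<star> \<pi>"
| "fmlookup bs c = Some (x, t) \<Longrightarrow> cas (Constr c v) bs \<star> \<pi> \<succ> t[x :=\<^sub>\<lambda> v] \<star> \<pi>"

definition final :: "('l, 'c) prc \<Rightarrow> bool" where
  "final p \<longleftrightarrow> (\<exists>v \<alpha>. p = Val v \<star> SVar \<alpha>)"

definition converges :: "(('l, 'c) prc \<Rightarrow> ('l, 'c) prc \<Rightarrow> bool) \<Rightarrow> ('l, 'c) prc \<Rightarrow> bool" where
  "converges R p \<longleftrightarrow> (\<exists>q. R\<^sup>*\<^sup>* p q \<and> final q)"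

text \<open>
  \<open>dred i\<close> is the reduction with the \<open>\<delta>\<close>-rule at level \<open>i\<close> and \<open>eqv i\<close> is observational
  equivalence at level \<open>i\<close>: \<open>dred i\<close> uses \<open>eqv j\<close> for \<open>j < i\<close> only, and \<open>eqv i\<close> uses
  \<open>dred j\<close> for \<open>j \<le> i\<close>.
\<close>

context
  notes conj_cong [fundef_cong] imp_cong [fundef_cong]
begin

function
  dred :: "nat \<Rightarrow> ('l, 'c) prc \<Rightarrow> ('l, 'c) prc \<Rightarrow> bool" and
  eqv :: "nat \<Rightarrow> ('l, 'c) trm \<Rightarrow> ('l, 'c) trm \<Rightarrow> bool"
where
  "dred i = (\<lambda>p q. p \<succ> q \<or>
     (\<exists>v w \<pi>. p = Delta v w \<star> \<pi> \<and> q = Val v \<star> \<pi> \<and> (\<exists>j<i. \<not> eqv j (Val v) (Val w))))"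
| "eqv i = (\<lambda>t u. \<forall>j\<le>i. \<forall>\<pi> \<sigma>.
     converges (dred j) (sub_t t \<sigma> \<star> \<pi>) \<longleftrightarrow> converges (dred j) (sub_t u \<sigma> \<star> \<pi>))"
  by pat_completeness auto
termination
  by (relation "measure (case_sum (\<lambda>i. 2 * i) (\<lambda>i. Suc (2 * i)))") auto

end

declare dred.simps [simp del] eqv.simps [simp del]

definition equivalent :: "('l, 'c) trm \<Rightarrow> ('l, 'c) trm \<Rightarrow> bool"  (infix "\<approx>" 50) where
  "t \<approx> u \<longleftrightarrow> (\<forall>i. eqv i t u)"

end

theory Submission
  imports Defs
begin

text \<open>
  For every substitution \<open>\<sigma>\<close> and stack \<open>\<pi>\<close>, the process \<open>((\<lambda>x t) v)\<sigma> \<star> \<pi>\<close> reaches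
  \<open>t[x := v]\<sigma> \<star> \<pi>\<close> in three steps, each of them the only reduction available at every level and none
  of them starting from a final process; hence the two processes converge together. The uniqueness
  of the \<open>\<beta>\<close>-step rests on the independence of its contractum from the chosen name of the bound
  variable, its existence on the fact that a term has finitely many free variables.
\<close>

lemma lift_simps [simp]: "lift f 0 = 0" "lift f (Suc k) = Suc (f k)"
  by (simp_all add: lift_def)

lemma lift_comp: "lift f \<circ> lift g = lift (f \<circ> g)"
  by (auto simp: fun_eq_iff lift_def split: nat.split)

lemma lift_id [simp]: "lift id = id"
  by (auto simp: fun_eq_iff lift_def split: nat.split)

lemma fmmap_cong_ran:
  assumes "\<And>x. x \<in> fmran' m \<Longrightarrow> f x = g x"
  shows "fmmap f m = fmmap g m"
  using assms by (rule fmap.map_cong0)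

section \<open>Renaming and substitution\<close>

lemma ren_ren:
  fixes v :: "('l, 'c) val" and t :: "('l, 'c) trm" and \<pi> :: "('l, 'c) stk" and p :: "('l, 'c) prc"
  shows "ren_v (ren_v v f g) f' g' = ren_v v (f' \<circ> f) (g' \<circ> g)"
  "ren_t (ren_t t f g) f' g' = ren_t t (f' \<circ> f) (g' \<circ> g)"
  "ren_s (ren_s \<pi> f g) f' g' = ren_s \<pi> (f' \<circ> f) (g' \<circ> g)"
  "ren_p (ren_p p f g) f' g' = ren_p p (f' \<circ> f) (g' \<circ> g)"
  by (induction v and t and \<pi> and p arbitrary: f g f' g' and f g f' g' and f g f' g' and f g f' g')
     (auto simp: fmap.map_comp lift_comp intro!: fmmap_cong_ran)

lemma ren_id [simp]:
  fixes v :: "('l, 'c) val" and t :: "('l, 'c) trm" and \<pi> :: "('l, 'c) stk" and p :: "('l, 'c) prc"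
  shows "ren_v v id id = v"
  "ren_t t id id = t"
  "ren_s \<pi> id id = \<pi>"
  "ren_p p id id = p"
  by (induction v and t and \<pi> and p) (auto simp: lift_id [unfolded id_def] id_def intro!: fmap.map_ident_strong)

text \<open>A \<lambda>-binder lifts only \<open>f\<close>: stack indices live in a separate space,
  so \<open>g\<close> passes unchanged. The components are spelled out to match the substitution
  that \<open>sub_ren\<close> carries under a binder.\<close>

lemma up_l_ren: "up_l (Sbst (a \<circ> f) (b \<circ> g) c) =
    Sbst (on_lvar (up_l (Sbst a b c)) \<circ> lift f) (on_svar (up_l (Sbst a b c)) \<circ> g)
      (on_tvar (up_l (Sbst a b c)))"
  by (auto simp: up_l_def fun_eq_iff lift_def split: nat.split)

lemma up_s_ren: "up_s (Sbst (a \<circ> f) (b \<circ> g) c) =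
    Sbst (on_lvar (up_s (Sbst a b c)) \<circ> f) (on_svar (up_s (Sbst a b c)) \<circ> lift g)
      (on_tvar (up_s (Sbst a b c)))"
  by (auto simp: up_s_def fun_eq_iff lift_def split: nat.split)

text \<open>A preceding renaming is absorbed by precomposition. The induction generalises
  \<open>f\<close>, \<open>g\<close> and \<open>\<sigma>\<close>, because each binder lifts
  them.\<close>

lemma sub_ren:
  fixes v :: "('l, 'c) val" and t :: "('l, 'c) trm" and \<pi> :: "('l, 'c) stk" and p :: "('l, 'c) prc"
  shows "sub_v (ren_v v f g) \<sigma> = sub_v v (Sbst (on_lvar \<sigma> \<circ> f) (on_svar \<sigma> \<circ> g) (on_tvar \<sigma>))"
  "sub_t (ren_t t f g) \<sigma> = sub_t t (Sbst (on_lvar \<sigma> \<circ> f) (on_svar \<sigma> \<circ> g) (on_tvar \<sigma>))"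
  "sub_s (ren_s \<pi> f g) \<sigma> = sub_s \<pi> (Sbst (on_lvar \<sigma> \<circ> f) (on_svar \<sigma> \<circ> g) (on_tvar \<sigma>))"
  "sub_p (ren_p p f g) \<sigma> = sub_p p (Sbst (on_lvar \<sigma> \<circ> f) (on_svar \<sigma> \<circ> g) (on_tvar \<sigma>))"
  by (induction v and t and \<pi> and p arbitrary: f g \<sigma> and f g \<sigma> and f g \<sigma> and f g \<sigma>)
     (auto simp: fmap.map_comp up_l_ren up_s_ren intro!: fmmap_cong_ran)

definition ren_sbst :: "(lvar \<Rightarrow> lvar) \<Rightarrow> (svar \<Rightarrow> svar) \<Rightarrow> ('l, 'c) sbst \<Rightarrow> ('l, 'c) sbst" where
  "ren_sbst f g \<sigma> = Sbst (\<lambda>x. ren_v (on_lvar \<sigma> x) f g) (\<lambda>\<alpha>. ren_s (on_svar \<sigma> \<alpha>) f g)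
     (\<lambda>a. ren_t (on_tvar \<sigma> a) f g)"

lemma ren_sbst_sel [simp]:
  "on_lvar (ren_sbst f g \<sigma>) x = ren_v (on_lvar \<sigma> x) f g"
  "on_svar (ren_sbst f g \<sigma>) \<alpha> = ren_s (on_svar \<sigma> \<alpha>) f g"
  "on_tvar (ren_sbst f g \<sigma>) a = ren_t (on_tvar \<sigma> a) f g"
  by (simp_all add: ren_sbst_def)

text \<open>Naturality of the shift past a binder; this is why renaming a substitution commutes with
  pushing it under a binder.\<close>

lemma lift_comp_Suc: "lift f \<circ> Suc = Suc \<circ> f"
  by (simp add: fun_eq_iff)

lemma up_l_ren_sbst: "up_l (ren_sbst f g \<sigma>) = ren_sbst (lift f) g (up_l \<sigma>)"
  by (auto simp: up_l_def ren_sbst_def fun_eq_iff ren_ren lift_comp_Suc split: nat.split)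

lemma up_s_ren_sbst: "up_s (ren_sbst f g \<sigma>) = ren_sbst f (lift g) (up_s \<sigma>)"
  by (auto simp: up_s_def ren_sbst_def fun_eq_iff ren_ren lift_comp_Suc split: nat.split)

lemma ren_sub:
  fixes v :: "('l, 'c) val" and t :: "('l, 'c) trm" and \<pi> :: "('l, 'c) stk" and p :: "('l, 'c) prc"
  shows "ren_v (sub_v v \<sigma>) f g = sub_v v (ren_sbst f g \<sigma>)"
  "ren_t (sub_t t \<sigma>) f g = sub_t t (ren_sbst f g \<sigma>)"
  "ren_s (sub_s \<pi> \<sigma>) f g = sub_s \<pi> (ren_sbst f g \<sigma>)"
  "ren_p (sub_p p \<sigma>) f g = sub_p p (ren_sbst f g \<sigma>)"
  by (induction v and t and \<pi> and p arbitrary: f g \<sigma> and f g \<sigma> and f g \<sigma> and f g \<sigma>)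
     (auto simp: fmap.map_comp up_l_ren_sbst up_s_ren_sbst intro!: fmmap_cong_ran)

text \<open>Arguments are ordered as for \<open>\<circ>\<close>: \<open>\<sigma>\<close> acts first,
  then \<open>\<tau>\<close>.\<close>

definition comp_sbst :: "('l, 'c) sbst \<Rightarrow> ('l, 'c) sbst \<Rightarrow> ('l, 'c) sbst" where
  "comp_sbst \<tau> \<sigma> = Sbst (\<lambda>x. sub_v (on_lvar \<sigma> x) \<tau>) (\<lambda>\<alpha>. sub_s (on_svar \<sigma> \<alpha>) \<tau>)
     (\<lambda>a. sub_t (on_tvar \<sigma> a) \<tau>)"

lemma comp_sbst_sel [simp]:
  "on_lvar (comp_sbst \<tau> \<sigma>) x = sub_v (on_lvar \<sigma> x) \<tau>"
  "on_svar (comp_sbst \<tau> \<sigma>) \<alpha> = sub_s (on_svar \<sigma> \<alpha>) \<tau>"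
  "on_tvar (comp_sbst \<tau> \<sigma>) a = sub_t (on_tvar \<sigma> a) \<tau>"
  by (simp_all add: comp_sbst_def)

text \<open>After a shift, index 0 is never looked up, so only the shifted images of
  \<open>\<tau>\<close> remain. The left side, including \<open>\<circ> id\<close>, has the shape
  that \<open>sub_ren\<close> produces.\<close>

lemma up_l_shift:
  "Sbst (on_lvar (up_l \<tau>) \<circ> Suc) (on_svar (up_l \<tau>) \<circ> id) (on_tvar (up_l \<tau>)) = ren_sbst Suc id \<tau>"
  by (simp add: up_l_def ren_sbst_def comp_def)

lemma up_s_shift:
  "Sbst (on_lvar (up_s \<tau>) \<circ> id) (on_svar (up_s \<tau>) \<circ> Suc) (on_tvar (up_s \<tau>)) = ren_sbst id Suc \<tau>"
  by (simp add: up_s_def ren_sbst_def comp_def)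

lemma up_l_comp_sbst: "up_l (comp_sbst \<tau> \<sigma>) = comp_sbst (up_l \<tau>) (up_l \<sigma>)"
proof -
  \<comment> \<open>Shifting commutes with substitution: both sides amount to substituting with
    \<open>ren_sbst Suc id \<tau>\<close>.\<close>
  have "sub_v (ren_v v Suc id) (up_l \<tau>) = ren_v (sub_v v \<tau>) Suc id"
    and "sub_s (ren_s \<pi> Suc id) (up_l \<tau>) = ren_s (sub_s \<pi> \<tau>) Suc id"
    and "sub_t (ren_t t Suc id) (up_l \<tau>) = ren_t (sub_t t \<tau>) Suc id" for v \<pi> t
    by (simp_all only: sub_ren up_l_shift ren_sub)
  moreover have "on_lvar (up_l \<tau>) 0 = Var 0"
    by (simp add: up_l_def)
  ultimately show ?thesis
    unfolding up_l_def [of "comp_sbst \<tau> \<sigma>"] up_l_def [of \<sigma>] comp_sbst_def [of "up_l \<tau>"]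
    by (auto simp: fun_eq_iff split: nat.split)
qed

lemma up_s_comp_sbst: "up_s (comp_sbst \<tau> \<sigma>) = comp_sbst (up_s \<tau>) (up_s \<sigma>)"
proof -
  have "sub_v (ren_v v id Suc) (up_s \<tau>) = ren_v (sub_v v \<tau>) id Suc"
    and "sub_s (ren_s \<pi> id Suc) (up_s \<tau>) = ren_s (sub_s \<pi> \<tau>) id Suc"
    and "sub_t (ren_t t id Suc) (up_s \<tau>) = ren_t (sub_t t \<tau>) id Suc" for v \<pi> t
    by (simp_all only: sub_ren up_s_shift ren_sub)
  moreover have "on_svar (up_s \<tau>) 0 = SVar 0"
    by (simp add: up_s_def)
  ultimately show ?thesis
    unfolding up_s_def [of "comp_sbst \<tau> \<sigma>"] up_s_def [of \<sigma>] comp_sbst_def [of "up_s \<tau>"]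
    by (auto simp: fun_eq_iff split: nat.split)
qed

lemma sub_sub:
  fixes v :: "('l, 'c) val" and t :: "('l, 'c) trm" and \<pi> :: "('l, 'c) stk" and p :: "('l, 'c) prc"
  shows "sub_v (sub_v v \<sigma>) \<tau> = sub_v v (comp_sbst \<tau> \<sigma>)"
  "sub_t (sub_t t \<sigma>) \<tau> = sub_t t (comp_sbst \<tau> \<sigma>)"
  "sub_s (sub_s \<pi> \<sigma>) \<tau> = sub_s \<pi> (comp_sbst \<tau> \<sigma>)"
  "sub_p (sub_p p \<sigma>) \<tau> = sub_p p (comp_sbst \<tau> \<sigma>)"
  by (induction v and t and \<pi> and p arbitrary: \<sigma> \<tau> and \<sigma> \<tau> and \<sigma> \<tau> and \<sigma> \<tau>)
     (auto simp: fmap.map_comp up_l_comp_sbst up_s_comp_sbst intro!: fmmap_cong_ran)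

abbreviation id_sbst :: "('l, 'c) sbst" where
  "id_sbst \<equiv> Sbst Var SVar TVar"

lemma up_l_id_sbst [simp]: "up_l id_sbst = id_sbst"
  by (auto simp: up_l_def fun_eq_iff split: nat.split)

lemma up_s_id_sbst [simp]: "up_s id_sbst = id_sbst"
  by (auto simp: up_s_def fun_eq_iff split: nat.split)

lemma sub_id_sbst [simp]:
  fixes v :: "('l, 'c) val" and t :: "('l, 'c) trm" and \<pi> :: "('l, 'c) stk" and p :: "('l, 'c) prc"
  shows "sub_v v id_sbst = v"
  "sub_t t id_sbst = t"
  "sub_s \<pi> id_sbst = \<pi>"
  "sub_p p id_sbst = p"
  by (induction v and t and \<pi> and p) (auto intro!: fmap.map_ident_strong)

section \<open>Terms have finitely many free variables\<close>

lemma finite_bound_exists: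
  fixes P :: "'a \<Rightarrow> nat \<Rightarrow> bool"
  assumes "finite A" and "\<And>a. a \<in> A \<Longrightarrow> \<exists>n. P a n"
    and mono: "\<And>a m n. P a m \<Longrightarrow> m \<le> n \<Longrightarrow> P a n"
  shows "\<exists>n. \<forall>a\<in>A. P a n"
  using assms(1,2)
proof (induction A)
  case (insert a A)
  from insert.prems obtain m where "P a m"
    by blast
  moreover from insert obtain n where "\<forall>b\<in>A. P b n"
    by blast
  ultimately have "\<forall>b\<in>insert a A. P b (max m n)"
    using mono by (metis insert_iff max.cobounded1 max.cobounded2)
  then show ?case ..
qed simp

lemma finite_fmran': "finite (fmran' m)"
  by (simp add: fmran'_alt_def)

definition eq_upto :: "nat \<Rightarrow> (nat \<Rightarrow> 'a) \<Rightarrow> (nat \<Rightarrow> 'a) \<Rightarrow> bool" where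
  "eq_upto n f f' \<longleftrightarrow> (\<forall>k<n. f k = f' k)"

lemma eq_upto_mono: "eq_upto n f f' \<Longrightarrow> m \<le> n \<Longrightarrow> eq_upto m f f'"
  by (simp add: eq_upto_def)

lemma eq_upto_max [simp]: "eq_upto (max m n) f f' \<longleftrightarrow> eq_upto m f f' \<and> eq_upto n f f'"
  by (auto simp: eq_upto_def less_max_iff_disj)

text \<open>Lifting moves the agreement up by one index; keeping the same \<open>n\<close> lets a
  bound for a body serve for its abstraction.\<close>

lemma eq_upto_lift: "eq_upto n f f' \<Longrightarrow> eq_upto n (lift f) (lift f')"
  by (auto simp: eq_upto_def lift_def split: nat.split)

text \<open>Finiteness of the set of free \<lambda>-variables, phrased without that set: some
  \<open>n\<close> exceeds every index on which the renaming can depend. Bounds of subterms are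
  combined by \<open>max\<close>, and over records and branches by finiteness of the map.\<close>

lemma ren_cong_bound:
  fixes v :: "('l, 'c) val" and t :: "('l, 'c) trm" and \<pi> :: "('l, 'c) stk" and p :: "('l, 'c) prc"
  shows "\<exists>n. \<forall>f f' g. eq_upto n f f' \<longrightarrow> ren_v v f g = ren_v v f' g"
  "\<exists>n. \<forall>f f' g. eq_upto n f f' \<longrightarrow> ren_t t f g = ren_t t f' g"
  "\<exists>n. \<forall>f f' g. eq_upto n f f' \<longrightarrow> ren_s \<pi> f g = ren_s \<pi> f' g"
  "\<exists>n. \<forall>f f' g. eq_upto n f f' \<longrightarrow> ren_p p f g = ren_p p f' g"
proof (induction v and t and \<pi> and p)
  case (Var x)
  \<comment> \<open>Agreement is below a strict bound, so covering index \<open>x\<close> takes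
    \<open>Suc x\<close>.\<close>
  show ?case by (rule exI [of _ "Suc x"]) (simp add: eq_upto_def)
next
  case (Record vs)
  have "\<exists>n. \<forall>v\<in>fmran' vs. \<forall>f f' g. eq_upto n f f' \<longrightarrow> ren_v v f g = ren_v v f' g"
    by (rule finite_bound_exists) (use Record eq_upto_mono finite_fmran' in blast)+
  then obtain n where "\<forall>v\<in>fmran' vs. \<forall>f f' g. eq_upto n f f' \<longrightarrow> ren_v v f g = ren_v v f' g" ..
  then have "\<forall>f f' g. eq_upto n f f' \<longrightarrow> ren_v (Record vs) f g = ren_v (Record vs) f' g"
    by (auto intro!: fmmap_cong_ran)
  then show ?case ..
next
  case (CASE v ts)
  have "\<exists>n. \<forall>t\<in>fmran' ts. \<forall>f f' g. eq_upto n f f' \<longrightarrow> ren_t t f g = ren_t t f' g"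
    by (rule finite_bound_exists) (use CASE eq_upto_mono finite_fmran' in blast)+
  then obtain n where "\<forall>t\<in>fmran' ts. \<forall>f f' g. eq_upto n f f' \<longrightarrow> ren_t t f g = ren_t t f' g" ..
  \<comment> \<open>Each branch is renamed under its own binder, hence with lifted
    renamings.\<close>
  then have n': "\<forall>t\<in>fmran' ts. \<forall>f f' g. eq_upto n f f' \<longrightarrow> ren_t t (lift f) g = ren_t t (lift f') g"
    using eq_upto_lift by blast
  obtain m where m: "\<forall>f f' g. eq_upto m f f' \<longrightarrow> ren_v v f g = ren_v v f' g"
    using CASE by blast
  have "\<forall>f f' g. eq_upto (max m n) f f' \<longrightarrow> ren_t (CASE v ts) f g = ren_t (CASE v ts) f' g"
    using m n' by (auto intro!: fmmap_cong_ran)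
  then show ?case ..
next
  case (LAM t)
  then show ?case by simp (metis eq_upto_lift)
next
  case (App t u)
  then show ?case by simp (metis eq_upto_max)
next
  case (Delta v w)
  then show ?case by simp (metis eq_upto_max)
next
  case (Push v \<pi>)
  then show ?case by simp (metis eq_upto_max)
next
  case (Frame t \<pi>)
  then show ?case by simp (metis eq_upto_max)
next
  case (Cut t \<pi>)
  then show ?case by simp (metis eq_upto_max)
qed (simp; metis)+

text \<open>An index beyond the free variables of the body is a fresh name for the bound variable:
  index 0 is renamed to it and the others drop by one; abstracting that name reverses this.\<close>

lemma LAM_eq_lam:
  obtains x t where "LAM s = lam x t"
proof -
  obtain n where n: "\<forall>f f' g. eq_upto n f f' \<longrightarrow> ren_t s f g = ren_t s f' g"
    using ren_cong_bound(2) by blast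
  \<comment> \<open>The composite differs from \<open>id\<close> only at \<open>Suc n\<close>, where
    \<open>n\<close> is captured as the bound name; this index lies outside the bound.\<close>
  have "eq_upto n (bind n \<circ> case_nat n id) id"
    by (auto simp: eq_upto_def bind_def split: nat.split)
  with n have "ren_t (ren_t s (case_nat n id) id) (bind n) id = s"
    by (simp add: ren_ren)
  then have "LAM s = lam n (ren_t s (case_nat n id) id)"
    by (simp add: lam_def)
  then show thesis by (rule that)
qed

section \<open>Beta reduction\<close>

text \<open>Substitution at a beta-step in de Bruijn form: index 0 receives \<open>v\<close>, and
  the other indices drop by one as the binder disappears.\<close>

definition inst :: "('l, 'c) val \<Rightarrow> ('l, 'c) sbst" where
  "inst v = Sbst (case_nat v Var) SVar TVar"

text \<open>Named substitution factors through \<open>bind x\<close>, so the contractum depends only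
  on the body stored in \<open>lam x t\<close> and not on the choice of \<open>x\<close> and
  \<open>t\<close>.\<close>

lemma subst_l_eq_inst: "t[x :=\<^sub>\<lambda> v] = sub_t (ren_t t (bind x) id) (inst v)"
proof -
  have "Var(x := v) = case_nat v Var \<circ> bind x"
    by (auto simp: bind_def)
  then show ?thesis
    by (simp add: subst_l_def sub_ren inst_def)
qed

lemma red_LAM_Push_iff: "Val (LAM s) \<star> Push v \<pi> \<succ> q \<longleftrightarrow> q = sub_t s (inst v) \<star> \<pi>"
proof
  assume "Val (LAM s) \<star> Push v \<pi> \<succ> q"
  then show "q = sub_t s (inst v) \<star> \<pi>"
    \<comment> \<open>Unfolding the named binders exposes the constructors, which excludes every
      rule but beta; the name in that rule vanishes by \<open>subst_l_eq_inst\<close>.\<close>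
    by cases (auto simp: lam_def mu_def cas_def subst_l_eq_inst)
next
  assume q: "q = sub_t s (inst v) \<star> \<pi>"
  obtain x t where "LAM s = lam x t"
    by (rule LAM_eq_lam)
  then show "Val (LAM s) \<star> Push v \<pi> \<succ> q"
    using q red.intros(3) [of x t v \<pi>] by (simp add: lam_def subst_l_eq_inst)
qed

lemma red_App_iff: "App t u \<star> \<pi> \<succ> q \<longleftrightarrow> q = u \<star> Frame t \<pi>"
  by (auto simp: mu_def cas_def intro: red.intros elim: red.cases)

lemma red_Val_Frame_iff: "Val v \<star> Frame t \<pi> \<succ> q \<longleftrightarrow> q = t \<star> Push v \<pi>"
  by (auto simp: mu_def cas_def intro: red.intros elim: red.cases)

text \<open>Beta-contraction commutes with substitution: both composites send index 0 to
  \<open>sub_v v \<sigma>\<close> and index \<open>Suc k\<close> to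
  \<open>on_lvar \<sigma> k\<close>.\<close>

lemma sub_ren_bind_up_l_inst:
  "sub_t (sub_t (ren_t t (bind x) id) (up_l \<sigma>)) (inst (sub_v v \<sigma>)) = sub_t (t[x :=\<^sub>\<lambda> v]) \<sigma>"
proof -
  \<comment> \<open>\<open>inst\<close> cancels the shift that \<open>up_l\<close> applies to the
    images of \<open>\<sigma>\<close>.\<close>
  have "sub_v (ren_v u Suc id) (inst w) = u"
    and "sub_s (ren_s \<pi> Suc id) (inst w) = \<pi>"
    and "sub_t (ren_t s Suc id) (inst w) = s" for u \<pi> s and w :: "('a, 'b) val"
    by (simp_all add: sub_ren inst_def comp_def)
  then have "comp_sbst (inst (sub_v v \<sigma>)) (up_l \<sigma>) =
      Sbst (case_nat (sub_v v \<sigma>) (on_lvar \<sigma>)) (on_svar \<sigma>) (on_tvar \<sigma>)"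
    by (auto simp: comp_sbst_def up_l_def fun_eq_iff inst_def split: nat.split)
  moreover have "comp_sbst \<sigma> (inst v) =
      Sbst (case_nat (sub_v v \<sigma>) (on_lvar \<sigma>)) (on_svar \<sigma>) (on_tvar \<sigma>)"
    by (auto simp: comp_sbst_def fun_eq_iff inst_def split: nat.split)
  ultimately show ?thesis
    by (simp add: subst_l_eq_inst sub_sub)
qed

text \<open>As \<open>p\<close> is not final, a run from \<open>p\<close> to a final process is
  nonempty and must begin with the step to \<open>p'\<close>; conversely, that step can be prepended
  to any run from \<open>p'\<close>.\<close>

lemma converges_unique_step:
  assumes "\<And>q. R p q \<longleftrightarrow> q = p'" and "\<not> final p"
  shows "converges R p \<longleftrightarrow> converges R p'"
  unfolding converges_def using assms
  by (metis converse_rtranclpE converse_rtranclp_into_rtranclp)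

theorem theorem9:
  fixes x :: lvar
    and t :: "('l::countable, 'c::countable) trm"
    and v :: "('l, 'c) val"
  shows "App (Val (lam x t)) (Val v) \<approx> t[x :=\<^sub>\<lambda> v]"
proof -
  have "converges (dred j) (sub_t (App (Val (lam x t)) (Val v)) \<sigma> \<star> \<pi>) \<longleftrightarrow>
      converges (dred j) (sub_t (t[x :=\<^sub>\<lambda> v]) \<sigma> \<star> \<pi>)" for j \<sigma> \<pi>
  proof -
    \<comment> \<open>The body of the abstraction after \<open>\<sigma>\<close> has passed its
      binder.\<close>
    define s where "s = sub_t (ren_t t (bind x) id) (up_l \<sigma>)"
    define w where "w = sub_v v \<sigma>"
    \<comment> \<open>No head in the three steps is a \<open>Delta\<close>, so \<open>dred j\<close>
      offers exactly the \<open>\<succ>\<close>-steps, whatever \<open>j\<close> is.\<close>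
    have "converges (dred j) (App (Val (LAM s)) (Val w) \<star> \<pi>) \<longleftrightarrow>
        converges (dred j) (Val w \<star> Frame (Val (LAM s)) \<pi>)"
      by (rule converges_unique_step) (simp_all add: dred.simps red_App_iff final_def)
    also have "\<dots> \<longleftrightarrow> converges (dred j) (Val (LAM s) \<star> Push w \<pi>)"
      by (rule converges_unique_step) (simp_all add: dred.simps red_Val_Frame_iff final_def)
    also have "\<dots> \<longleftrightarrow> converges (dred j) (sub_t s (inst w) \<star> \<pi>)"
      by (rule converges_unique_step) (simp_all add: dred.simps red_LAM_Push_iff final_def)
    also have "sub_t s (inst w) = sub_t (t[x :=\<^sub>\<lambda> v]) \<sigma>"
      unfolding s_def w_def by (rule sub_ren_bind_up_l_inst)
    finally show ?thesis
      by (simp add: lam_def s_def w_def)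
  qed
  then show ?thesis
    by (simp add: equivalent_def eqv.simps)
qed

end
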